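(* Let $A=R[y_1,y_2]$ be a Poisson double extension of a Poisson algebra $R$ with variables $y_1,y_2$ and PDE-data $$\left\{q=\{q_{11},q_{12}\},\ \alpha=\begin{pmatrix}\alpha_{11}&\alpha_{12}\\ \alpha_{21}&\alpha_{22}\end{pmatrix},\ \nu=\begin{pmatrix}\nu_1\\ \nu_2\end{pmatrix},\ w=\{w_1,w_2,w_0\}\right\}.$$ Then $A$ can be presented as an iterated Poisson polynomial extension of the form $$A=R[y_1;\beta_1,\delta_1]_p[y_2;\beta_2,\delta_2]_p\quad\text{or}\quad A=R[y_2;\beta_2,\delta_2]_p[y_1;\beta_1,\delta_1]_p$$ if and only if $\alpha_{12}=0$, or both $\alpha_{21}=0$ and $q_{11}=0$. In such cases the following hold. (1) If $\alpha_{12}=0$, then $A=R[y_1;\alpha_{11},\nu_1]_p[y_2;\beta,\mu]_p$, where $$\begin{aligned}\beta(a)&=\alpha_{22}(a),&\beta(y_1)&=q_{12}y_1+w_2,\\ \mu(a)&=\alpha_{21}(a)y_1+\nu_2(a),&\mu(y_1)&=q_{11}y_1^2+w_1y_1+w_0\end{aligned}$$ for all $a\in R$. (2) If $\alpha_{21}=0$ and $q_{11}=0$, then $A=R[y_2;\alpha_{22},\nu_2]_p[y_1;\beta,\mu]_p$, where $$\begin{aligned}\beta(a)&=\alpha_{11}(a),&\beta(y_2)&=-q_{12}y_2-w_1,\\ \mu(a)&=\alpha_{12}(a)y_2+\nu_1(a),&\mu(y_2)&=-w_2y_2-w_0\end{aligned}$$ for all $a\in R$.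
   Context: ${\bf k}$ is a field of characteristic zero. A Poisson algebra is a commutative ${\bf k}$-algebra with a ${\bf k}$-bilinear bracket $\{-,-\}$ making it a Lie algebra and such that each $\{a,-\}$ is a derivation. A Poisson double extension of a Poisson algebra $R$ with variables $y_1,y_2$ and PDE-data $\{q,\alpha,\nu,w\}$, where $q=\{q_{11},q_{12}\}\subset{\bf k}$, $w=\{w_1,w_2,w_0\}\subset R$, $\alpha=(\alpha_{ij}):R\to M_{2\times 2}(R)$ and $\nu=(\nu_1,\nu_2)^T:R\to M_{2\times1}(R)$ are ${\bf k}$-linear, is the commutative polynomial ring $R[y_1,y_2]$ endowed with a Poisson bracket that restricts to the given bracket on $R$ and satisfies $\{y_2,y_1\}=q_{11}y_1^2+q_{12}y_1y_2+w_1y_1+w_2y_2+w_0$ and $\{y_i,a\}=\alpha_{i1}(a)y_1+\alpha_{i2}(a)y_2+\nu_i(a)$ for $i=1,2$ and $a\in R$. Poisson polynomial extension: for derivations $\beta,\nu$ of a Poisson algebra $R$, the polynomial ring $R[x]$ is a Poisson algebra containing $R$ as a Poisson subalgebra with $\{x,a\}=\beta(a)x+\nu(a)$ for all $a\in R$ if and only if $\beta$ is a Poisson derivation (i.e. also a derivation of the bracket) and $\nu(\{a,b\})=\{\nu(a),b\}+\{a,\nu(b)\}+\beta(a)\nu(b)-\nu(a)\beta(b)$ for all $a,b\in R$; this Poisson algebra is denoted $R[x;\beta,\nu]_p$. In an iterated extension $R[y_1;\beta_1,\delta_1]_p[y_2;\beta_2,\delta_2]_p$, the maps $\beta_2,\delta_2$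 are derivations of $R[y_1;\beta_1,\delta_1]_p$. *)

theory Defs
  imports "HOL-Computational_Algebra.Polynomial"
begin

locale poisson_algebra =
  vector_space scale
  for scale :: "'k::field_char_0 \<Rightarrow> 'a::comm_ring_1 \<Rightarrow> 'a" +
  fixes bracket :: "'a \<Rightarrow> 'a \<Rightarrow> 'a"
  assumes scale_mult_left: "scale k (a * b) = scale k a * b"
    and bracket_linear_left: "Vector_Spaces.linear scale scale (\<lambda>a. bracket a b)"
    and bracket_linear_right: "Vector_Spaces.linear scale scale (bracket a)"
    and bracket_self: "bracket a a = 0"
    and jacobi: "bracket a (bracket b c) + bracket b (bracket c a) + bracket c (bracket a b) = 0"
    and leibniz: "bracket a (b * c) = bracket a b * c + b * bracket a c"

definition derivation :: "('k::field_char_0 \<Rightarrow> 'a::comm_ring_1 \<Rightarrow> 'a) \<Rightarrow> ('a \<Rightarrow> 'a) \<Rightarrow> bool"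
  where "derivation scale d \<longleftrightarrow>
    Vector_Spaces.linear scale scale d \<and> (\<forall>a b. d (a * b) = d a * b + a * d b)"

definition poisson_derivation ::
    "('k::field_char_0 \<Rightarrow> 'a::comm_ring_1 \<Rightarrow> 'a) \<Rightarrow> ('a \<Rightarrow> 'a \<Rightarrow> 'a) \<Rightarrow> ('a \<Rightarrow> 'a) \<Rightarrow> bool"
  where "poisson_derivation scale bracket d \<longleftrightarrow>
    derivation scale d \<and> (\<forall>a b. d (bracket a b) = bracket (d a) b + bracket a (d b))"

text \<open>The scalars of the polynomial ring act through \<open>c \<mapsto> c \<cdot> 1\<close> in the coefficient algebra.\<close>

definition poly_scale :: "('k \<Rightarrow> 'a::comm_ring_1 \<Rightarrow> 'a) \<Rightarrow> 'k \<Rightarrow> 'a poly \<Rightarrow> 'a poly"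
  where "poly_scale scale c p = smult (scale c 1) p"

text \<open>
  \<open>poisson_poly_ext scale bracket \<beta> \<nu> Bracket\<close>: the polynomial ring in \<open>x = [:0, 1:]\<close> with the
  bracket \<open>Bracket\<close> is the Poisson algebra \<open>R[x; \<beta>, \<nu>]\<^sub>p\<close>.  The bracket is uniquely determined by
  the last two conditions.
\<close>

locale poisson_poly_ext =
  R: poisson_algebra scale bracket +
  A: poisson_algebra "poly_scale scale" Bracket
  for scale :: "'k::field_char_0 \<Rightarrow> 'a::comm_ring_1 \<Rightarrow> 'a"
    and bracket :: "'a \<Rightarrow> 'a \<Rightarrow> 'a"
    and \<beta> \<nu> :: "'a \<Rightarrow> 'a"
    and Bracket :: "'a poly \<Rightarrow> 'a poly \<Rightarrow> 'a poly" +
  assumes \<beta>_derivation: "poisson_derivation scale bracket \<beta>"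
    and \<nu>_derivation: "derivation scale \<nu>"
    and \<nu>_bracket: "\<nu> (bracket a b) = bracket (\<nu> a) b + bracket a (\<nu> b) + \<beta> a * \<nu> b - \<nu> a * \<beta> b"
    and Bracket_const: "Bracket [:a:] [:b:] = [:bracket a b:]"
    and Bracket_var: "Bracket [:0, 1:] [:a:] = [:\<beta> a:] * [:0, 1:] + [:\<nu> a:]"

text \<open>The bracket of \<open>R[x\<^sub>1; \<beta>\<^sub>1, \<delta>\<^sub>1]\<^sub>p[x\<^sub>2; \<beta>\<^sub>2, \<delta>\<^sub>2]\<^sub>p\<close>, with \<open>x\<^sub>1\<close> the inner and \<open>x\<^sub>2\<close> the outer variable.\<close>

definition iterated_poisson_ext ::
    "('k::field_char_0 \<Rightarrow> 'a::comm_ring_1 \<Rightarrow> 'a) \<Rightarrow> ('a \<Rightarrow> 'a \<Rightarrow> 'a) \<Rightarrow>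
     ('a \<Rightarrow> 'a) \<Rightarrow> ('a \<Rightarrow> 'a) \<Rightarrow> ('a poly \<Rightarrow> 'a poly) \<Rightarrow> ('a poly \<Rightarrow> 'a poly) \<Rightarrow>
     ('a poly poly \<Rightarrow> 'a poly poly \<Rightarrow> 'a poly poly) \<Rightarrow> bool"
  where "iterated_poisson_ext scale bracket \<beta>1 \<delta>1 \<beta>2 \<delta>2 Bracket \<longleftrightarrow>
    (\<exists>Bracket1. poisson_poly_ext scale bracket \<beta>1 \<delta>1 Bracket1 \<and>
       poisson_poly_ext (poly_scale scale) Bracket1 \<beta>2 \<delta>2 Bracket)"

text \<open>\<open>R[y\<^sub>1, y\<^sub>2]\<close> is represented as \<open>R[y\<^sub>1][y\<^sub>2]\<close>, with \<open>y\<^sub>1\<close> the inner variable.\<close>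

definition base :: "'a::comm_ring_1 \<Rightarrow> 'a poly poly"
  where "base a = [:[:a:]:]"

definition y1 :: "'a::comm_ring_1 poly poly"
  where "y1 = [:[:0, 1:]:]"

definition y2 :: "'a::comm_ring_1 poly poly"
  where "y2 = [:0, 1:]"

locale poisson_double_ext =
  R: poisson_algebra scale bracket +
  A: poisson_algebra "poly_scale (poly_scale scale)" Bracket
  for scale :: "'k::field_char_0 \<Rightarrow> 'a::comm_ring_1 \<Rightarrow> 'a"
    and bracket :: "'a \<Rightarrow> 'a \<Rightarrow> 'a"
    and q11 q12 :: 'k
    and \<alpha>11 \<alpha>12 \<alpha>21 \<alpha>22 \<nu>1 \<nu>2 :: "'a \<Rightarrow> 'a"
    and w1 w2 w0 :: 'a
    and Bracket :: "'a poly poly \<Rightarrow> 'a poly poly \<Rightarrow> 'a poly poly" +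
  assumes \<alpha>_linear:
      "Vector_Spaces.linear scale scale \<alpha>11" "Vector_Spaces.linear scale scale \<alpha>12"
      "Vector_Spaces.linear scale scale \<alpha>21" "Vector_Spaces.linear scale scale \<alpha>22"
    and \<nu>_linear: "Vector_Spaces.linear scale scale \<nu>1" "Vector_Spaces.linear scale scale \<nu>2"
    and Bracket_base: "Bracket (base a) (base b) = base (bracket a b)"
    and Bracket_y2_y1: "Bracket y2 y1 =
      poly_scale (poly_scale scale) q11 (y1 ^ 2) + poly_scale (poly_scale scale) q12 (y1 * y2)
      + base w1 * y1 + base w2 * y2 + base w0"
    and Bracket_y1_base: "Bracket y1 (base a) = base (\<alpha>11 a) * y1 + base (\<alpha>12 a) * y2 + base (\<nu>1 a)"
    and Bracket_y2_base: "Bracket y2 (base a) = base (\<alpha>21 a) * y1 + base (\<alpha>22 a) * y2 + base (\<nu>2 a)"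

text \<open>The canonical isomorphism between \<open>R[y\<^sub>1][y\<^sub>2]\<close> and \<open>R[y\<^sub>2][y\<^sub>1]\<close>.\<close>

definition swap_vars :: "'a::comm_ring_1 poly poly \<Rightarrow> 'a poly poly"
  where "swap_vars p = poly (map_poly (map_poly (\<lambda>a. [:a:])) p) [:[:0, 1:]:]"

lemma coeff_swap_vars: "coeff (coeff (swap_vars p) i) j = coeff (coeff p j) i"
proof (induction p arbitrary: j)
  case 0
  show ?case by (simp add: swap_vars_def)
next
  case (pCons a p)
  have "swap_vars (pCons a p) = map_poly (\<lambda>a. [:a:]) a + smult [:0, 1:] (swap_vars p)"
    by (simp add: swap_vars_def map_poly_pCons)
  then show ?case
    using pCons.IH by (cases j) (auto simp: coeff_map_poly)
qed

definition presented_y1_y2 ::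
    "('k::field_char_0 \<Rightarrow> 'a::comm_ring_1 \<Rightarrow> 'a) \<Rightarrow> ('a \<Rightarrow> 'a \<Rightarrow> 'a) \<Rightarrow>
     ('a poly poly \<Rightarrow> 'a poly poly \<Rightarrow> 'a poly poly) \<Rightarrow>
     ('a \<Rightarrow> 'a) \<Rightarrow> ('a \<Rightarrow> 'a) \<Rightarrow> ('a poly \<Rightarrow> 'a poly) \<Rightarrow> ('a poly \<Rightarrow> 'a poly) \<Rightarrow> bool"
  where "presented_y1_y2 scale bracket Bracket \<beta>1 \<delta>1 \<beta>2 \<delta>2 \<longleftrightarrow>
    iterated_poisson_ext scale bracket \<beta>1 \<delta>1 \<beta>2 \<delta>2 Bracket"

text \<open>
  In \<open>R[y\<^sub>2; \<beta>\<^sub>2, \<delta>\<^sub>2]\<^sub>p[y\<^sub>1; \<beta>\<^sub>1, \<delta>\<^sub>1]\<^sub>p\<close> the inner variable is \<open>y\<^sub>2\<close>; the identification with the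
  algebra \<open>R[y\<^sub>1, y\<^sub>2]\<close> is along \<^const>\<open>swap_vars\<close>.
\<close>

definition presented_y2_y1 ::
    "('k::field_char_0 \<Rightarrow> 'a::comm_ring_1 \<Rightarrow> 'a) \<Rightarrow> ('a \<Rightarrow> 'a \<Rightarrow> 'a) \<Rightarrow>
     ('a poly poly \<Rightarrow> 'a poly poly \<Rightarrow> 'a poly poly) \<Rightarrow>
     ('a \<Rightarrow> 'a) \<Rightarrow> ('a \<Rightarrow> 'a) \<Rightarrow> ('a poly \<Rightarrow> 'a poly) \<Rightarrow> ('a poly \<Rightarrow> 'a poly) \<Rightarrow> bool"
  where "presented_y2_y1 scale bracket Bracket \<beta>2 \<delta>2 \<beta>1 \<delta>1 \<longleftrightarrow>
    (\<exists>Bracket'. iterated_poisson_ext scale bracket \<beta>2 \<delta>2 \<beta>1 \<delta>1 Bracket' \<and>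
       (\<forall>p q. swap_vars (Bracket' p q) = Bracket (swap_vars p) (swap_vars q)))"

end

theory Submission
  imports Defs
begin

text \<open>
  Being a biderivation, the bracket is determined by its values on generators, so degree bounds on
  these values propagate.  If \<open>\<alpha>\<^sub>1\<^sub>2 = 0\<close>, then \<open>R[y\<^sub>1]\<close> is closed under the bracket and
  \<open>{y\<^sub>2, p}\<close> has degree at most one in \<open>y\<^sub>2\<close> for \<open>p\<close> in \<open>R[y\<^sub>1]\<close>; its two coefficients are
  \<open>\<beta>(p)\<close> and \<open>\<mu>(p)\<close>, and their compatibility conditions are the Leibniz and Jacobi identities read
  off coefficientwise.  Exchanging the variables turns a double extension with \<open>q\<^sub>1\<^sub>1 = 0\<close> into
  another one, with \<open>\<alpha>\<^sub>1\<^sub>2\<close> and \<open>\<alpha>\<^sub>2\<^sub>1\<close> interchanged, which reduces the second presentation to the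
  first.
\<close>

section \<open>Poisson algebras, and when a bracket gives a polynomial extension\<close>

context poisson_algebra
begin

lemma bracket_add_left: "bracket (a + b) c = bracket a c + bracket b c"
  using bracket_linear_left by (simp add: Vector_Spaces.linear_iff)

lemma bracket_add_right: "bracket a (b + c) = bracket a b + bracket a c"
  using bracket_linear_right by (simp add: Vector_Spaces.linear_iff)

lemma bracket_scale_right: "bracket a (scale k b) = scale k (bracket a b)"
  using bracket_linear_right by (simp add: Vector_Spaces.linear_iff)

lemma bracket_antisym: "bracket a b = - bracket b a"
proof -
  have "bracket a b + bracket b a = bracket (a + b) (a + b)"
    by (simp add: bracket_add_left bracket_add_right bracket_self [of a] bracket_self [of b])
  then show ?thesis
    by (simp add: bracket_self eq_neg_iff_add_eq_0)
qed

lemma bracket_0_right [simp]: "bracket a 0 = 0"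
  using bracket_add_right [of a 0 0] by simp

lemma bracket_minus_right: "bracket a (- b) = - bracket a b"
  using bracket_add_right [of a b "- b"] by (simp add: eq_neg_iff_add_eq_0 add.commute)

lemma scale_eq_mult: "scale k a = scale k 1 * a"
  by (simp flip: scale_mult_left)

end

text \<open>All the axioms are identities, so each may be checked after applying the injective map
  \<open>f\<close>. It serves twice: for the inclusion of \<open>R[y1]\<close> as constants, and for
  the exchange of the variables.\<close>

lemma poisson_algebra_transfer:
  fixes f :: "'a::comm_ring_1 \<Rightarrow> 'b::comm_ring_1"
  assumes "poisson_algebra sB brB" and "inj f"
    and f_add: "\<And>x y. f (x + y) = f x + f y"
    and f_mult: "\<And>x y. f (x * y) = f x * f y"
    and f_scale: "\<And>k x. f (sA k x) = sB k (f x)"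
    and f_bracket: "\<And>x y. f (brA x y) = brB (f x) (f y)"
  shows "poisson_algebra sA brA"
proof -
  interpret B: poisson_algebra sB brB by fact
  have f_0: "f 0 = 0"
    using f_add [of 0 0] by simp
  have eqI: "x = y" if "f x = f y" for x y
    using that \<open>inj f\<close> by (simp add: inj_eq)
  note f_simps = f_add f_mult f_scale f_bracket f_0
  have vs: "vector_space sA"
    by unfold_locales
      (auto intro!: eqI simp: f_simps B.scale_right_distrib B.scale_left_distrib)
  have left: "brB (sB k x) y = sB k (brB x y)" for k x y
    using B.bracket_linear_left by (simp add: Vector_Spaces.linear_iff)
  have "Vector_Spaces.linear sA sA (\<lambda>a. brA a b)" "Vector_Spaces.linear sA sA (brA a)" for a b
    using vs by (auto simp: Vector_Spaces.linear_iff f_simps left B.bracket_add_left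
        B.bracket_add_right B.bracket_scale_right intro!: eqI)
  moreover have "sA k (a * b) = sA k a * b" for k a b
    by (rule eqI) (simp add: f_simps B.scale_mult_left)
  moreover have "brA a a = 0" for a
    by (rule eqI) (simp add: f_simps B.bracket_self)
  moreover have "brA a (brA b c) + brA b (brA c a) + brA c (brA a b) = 0" for a b c
    by (rule eqI) (simp add: f_simps B.jacobi)
  moreover have "brA a (b * c) = brA a b * c + b * brA a c" for a b c
    by (rule eqI) (simp add: f_simps B.leibniz)
  ultimately show ?thesis
    using vs by (simp add: poisson_algebra_def poisson_algebra_axioms_def)
qed

text \<open>The conditions on \<open>\<beta>\<close> and \<open>\<nu>\<close> need no separate
  verification: they are forced by the Poisson axioms of \<open>Bracket\<close>. Linearity and the
  Leibniz rule in the second argument make both maps derivations, and the Jacobi identity gives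
  their compatibility with \<open>bracket\<close>.\<close>

lemma poisson_poly_extI:
  assumes "poisson_algebra scale bracket"
    and "poisson_algebra (poly_scale scale) Bracket"
    and const: "\<And>a b. Bracket [:a:] [:b:] = [:bracket a b:]"
    and var: "\<And>a. Bracket [:0, 1:] [:a:] = [:\<beta> a:] * [:0, 1:] + [:\<nu> a:]"
  shows "poisson_poly_ext scale bracket \<beta> \<nu> Bracket"
proof -
  interpret R: poisson_algebra scale bracket by fact
  interpret A: poisson_algebra "poly_scale scale" Bracket by fact
  let ?x = "[:0, 1:]"
  have var': "Bracket ?x [:a:] = [:\<nu> a, \<beta> a:]" for a
    by (simp add: var)
  have add: "\<beta> (a + b) = \<beta> a + \<beta> b" "\<nu> (a + b) = \<nu> a + \<nu> b" for a b
    using A.bracket_add_right [of ?x "[:a:]" "[:b:]"] by (simp_all add: var')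
  have scale: "\<beta> (scale k a) = scale k (\<beta> a)" "\<nu> (scale k a) = scale k (\<nu> a)" for k a
    using A.bracket_scale_right [of ?x k "[:a:]"]
    by (simp_all add: poly_scale_def var' flip: R.scale_eq_mult)
  have mult: "\<beta> (a * b) = \<beta> a * b + a * \<beta> b" "\<nu> (a * b) = \<nu> a * b + a * \<nu> b" for a b
    using A.leibniz [of ?x "[:a:]" "[:b:]"] by (simp_all add: var' algebra_simps)
  \<comment> \<open>The inner brackets in the Jacobi identity below are linear in the variable, so
    \<open>const\<close> must first be extended from constants to such polynomials.\<close>
  have pair: "Bracket [:a:] [:c, d:]
      = [:bracket a c - d * \<nu> a, bracket a d - d * \<beta> a:]" for a c d
  proof -
    have "[:c, d:] = [:c:] + [:d:] * ?x"
      by simp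
    then have "Bracket [:a:] [:c, d:]
        = Bracket [:a:] [:c:] + (Bracket [:a:] [:d:] * ?x + [:d:] * Bracket [:a:] ?x)"
      by (simp only: A.bracket_add_right A.leibniz)
    also have "Bracket [:a:] ?x = - [:\<nu> a, \<beta> a:]"
      by (subst A.bracket_antisym) (simp only: var')
    finally show ?thesis
      by (simp add: const)
  qed
  have "Bracket ?x (Bracket [:a:] [:b:]) + Bracket [:a:] (Bracket [:b:] ?x)
      + Bracket [:b:] (Bracket ?x [:a:]) = 0" for a b
    by (rule A.jacobi)
  moreover have "Bracket [:b:] ?x = [:- \<nu> b, - \<beta> b:]" for b
    by (subst A.bracket_antisym) (simp add: var')
  \<comment> \<open>The linear and constant coefficients of the Jacobi identity for
    \<open>x\<close>, \<open>a\<close>, \<open>b\<close>.\<close>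
  ultimately have jac: "\<beta> (bracket a b) + (- bracket a (\<beta> b) + \<beta> b * \<beta> a)
        + (bracket b (\<beta> a) - \<beta> a * \<beta> b) = 0"
      "\<nu> (bracket a b) + (- bracket a (\<nu> b) + \<beta> b * \<nu> a)
        + (bracket b (\<nu> a) - \<beta> a * \<nu> b) = 0" for a b
    by (simp_all add: const var' pair R.bracket_minus_right)
  have "derivation scale \<beta>" "derivation scale \<nu>"
    using R.vector_space_axioms
    by (simp_all add: derivation_def Vector_Spaces.linear_iff add scale mult)
  moreover have "\<beta> (bracket a b) = bracket (\<beta> a) b + bracket a (\<beta> b)" for a b
    using jac(1) [of a b] R.bracket_antisym [of b "\<beta> a"] by (simp add: algebra_simps)
  moreover have "\<nu> (bracket a b)
      = bracket (\<nu> a) b + bracket a (\<nu> b) + \<beta> a * \<nu> b - \<nu> a * \<beta> b" for a b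
    using jac(2) [of a b] R.bracket_antisym [of b "\<nu> a"] by (simp add: algebra_simps)
  ultimately show ?thesis
    using assms
    by (simp add: poisson_poly_ext_def poisson_poly_ext_axioms_def poisson_derivation_def)
qed

text \<open>Induction along the Horner form of \<open>p\<close>: in the Leibniz rule the factors
  \<open>y1\<close> and \<open>[:p:]\<close> are constant in the outer variable, so multiplying by
  them cannot raise the degree.\<close>

lemma degree_derivation_const_le:
  fixes D :: "'a::comm_ring_1 poly poly \<Rightarrow> 'a poly poly"
  assumes add: "\<And>p q. D (p + q) = D p + D q"
    and mult: "\<And>p q. D (p * q) = D p * q + p * D q"
    and base: "\<And>a. degree (D (base a)) \<le> n" and y1: "degree (D y1) \<le> n"
  shows "degree (D [:p:]) \<le> n"
proof (induction p)
  case 0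
  show ?case using base [of 0] by (simp add: base_def)
next
  case (pCons a p)
  have "[:pCons a p:] = base a + y1 * [:p:]"
    by (simp add: base_def y1_def)
  then have "D [:pCons a p:] = D (base a) + (D y1 * [:p:] + y1 * D [:p:])"
    by (simp only: add mult)
  then have "D [:pCons a p:] = D (base a) + (smult p (D y1) + smult [:0, 1:] (D [:p:]))"
    by (simp add: y1_def)
  moreover have "degree (smult p (D y1)) \<le> n" "degree (smult [:0, 1:] (D [:p:])) \<le> n"
    using degree_smult_le y1 pCons.IH order_trans by blast+
  ultimately show ?case
    using base by (simp add: degree_add_le)
qed

section \<open>Exchanging the variables is an involutive algebra automorphism\<close>

lemma base_0 [simp]: "base 0 = 0"
  by (simp add: base_def)

lemma base_minus: "base (- a) = - base a"
  by (simp add: base_def)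

lemma swap_vars_swap_vars [simp]: "swap_vars (swap_vars p) = p"
  by (simp add: poly_eq_iff coeff_swap_vars)

lemma inj_swap_vars: "inj swap_vars"
  by (metis injI swap_vars_swap_vars)

lemma swap_vars_add: "swap_vars (p + q) = swap_vars p + swap_vars q"
  by (simp add: poly_eq_iff coeff_swap_vars)

lemma swap_vars_minus: "swap_vars (- p) = - swap_vars p"
  by (simp add: poly_eq_iff coeff_swap_vars)

lemma swap_vars_diff: "swap_vars (p - q) = swap_vars p - swap_vars q"
  by (simp add: poly_eq_iff coeff_swap_vars)

text \<open>The factor \<open>map_poly (\<lambda>c. [:c:]) a\<close> is
  \<open>swap_vars [:a:]\<close>: the polynomial \<open>a\<close> rewritten in the outer variable.
  This is the case of multiplicativity on which the general induction rests.\<close>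

lemma swap_vars_smult:
  "swap_vars (smult a p) = map_poly (\<lambda>c. [:c:]) a * swap_vars p"
  by (simp add: poly_eq_iff coeff_swap_vars coeff_mult coeff_sum coeff_map_poly)

lemma swap_vars_pCons:
  "swap_vars (pCons a p) = map_poly (\<lambda>c. [:c:]) a + [:[:0, 1:]:] * swap_vars p"
  by (simp add: swap_vars_def map_poly_pCons)

lemma swap_vars_mult: "swap_vars (p * q) = swap_vars p * swap_vars q"
proof (induction p)
  case 0
  show ?case by (simp add: swap_vars_def)
next
  case (pCons a p)
  have "swap_vars (pCons a p * q) = swap_vars (smult a q) + swap_vars (pCons 0 (p * q))"
    by (simp add: swap_vars_add)
  also have "\<dots> = swap_vars (pCons a p) * swap_vars q"
    by (simp add: swap_vars_smult swap_vars_pCons pCons.IH algebra_simps)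
  finally show ?case .
qed

lemma swap_vars_base [simp]: "swap_vars (base a) = base a"
  by (simp add: swap_vars_def base_def map_poly_pCons)

lemma swap_vars_y1 [simp]: "swap_vars y1 = y2"
  by (simp add: swap_vars_def y1_def y2_def map_poly_pCons)

lemma swap_vars_y2 [simp]: "swap_vars y2 = y1"
  by (metis swap_vars_y1 swap_vars_swap_vars)

lemma poly_scale_poly_scale: "poly_scale (poly_scale scale) c p = base (scale c 1) * p"
  by (simp add: poly_scale_def base_def)

lemma swap_vars_poly_scale:
  "swap_vars (poly_scale (poly_scale scale) c p) = poly_scale (poly_scale scale) c (swap_vars p)"
  by (simp add: poly_scale_poly_scale swap_vars_mult)

section \<open>The two presentations and the converse implications\<close>

context poisson_double_ext
begin

lemma presentation_y1_y2:
  assumes \<alpha>12: "\<And>a. \<alpha>12 a = 0"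
  shows "\<exists>\<beta> \<mu>. presented_y1_y2 scale bracket Bracket \<alpha>11 \<nu>1 \<beta> \<mu>
          \<and> (\<forall>a. \<beta> [:a:] = [:\<alpha>22 a:])
          \<and> \<beta> [:0, 1:] = poly_scale scale q12 [:0, 1:] + [:w2:]
          \<and> (\<forall>a. \<mu> [:a:] = [:\<alpha>21 a:] * [:0, 1:] + [:\<nu>2 a:])
          \<and> \<mu> [:0, 1:] = poly_scale scale q11 ([:0, 1:] ^ 2) + [:w1:] * [:0, 1:] + [:w0:]"
proof -
  define br where "br p q = coeff (Bracket [:p:] [:q:]) 0" for p q
  define \<beta> where "\<beta> p = coeff (Bracket y2 [:p:]) 1" for p
  define \<mu> where "\<mu> p = coeff (Bracket y2 [:p:]) 0" for p
  \<comment> \<open>Here \<open>\<alpha>12 = 0\<close> enters: no \<open>y2\<close> term is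
    left.\<close>
  have y1_base: "Bracket y1 (base a) = [:[:\<nu>1 a, \<alpha>11 a:]:]" for a
    by (simp add: Bracket_y1_base \<alpha>12) (simp add: base_def y1_def y2_def)
  have y2_base: "Bracket y2 (base a) = [:[:\<nu>2 a, \<alpha>21 a:], [:\<alpha>22 a:]:]" for a
    by (simp add: Bracket_y2_base) (simp add: base_def y1_def y2_def)
  have y2_y1: "Bracket y2 y1 = [:[:w0, w1, scale q11 1:], [:w2, scale q12 1:]:]"
    by (simp add: Bracket_y2_y1 poly_scale_poly_scale)
      (simp add: base_def y1_def y2_def power2_eq_square)
  have le: "degree (Bracket u [:p:]) \<le> n"
    if "\<And>a. degree (Bracket u (base a)) \<le> n" "degree (Bracket u y1) \<le> n" for u p n
    using A.bracket_add_right A.leibniz that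
    by (rule degree_derivation_const_le [where D = "Bracket u"])
  have degree_y1: "degree (Bracket y1 [:p:]) \<le> 0" for p
    by (rule le) (simp_all add: y1_base A.bracket_self)
  \<comment> \<open>The derivation bound controls only the second argument. It is applied with a
    generator in the first, the arguments are exchanged by antisymmetry, and then it is applied
    again for arbitrary \<open>[:p:]\<close>.\<close>
  have "degree (Bracket (base a) [:p:]) \<le> 0" for a p
    by (rule le) (simp_all add: Bracket_base A.bracket_antisym [of "base a" y1] y1_base,
        simp add: base_def)
  with degree_y1 have "degree (Bracket [:p:] (base a)) \<le> 0" "degree (Bracket [:p:] y1) \<le> 0"
    for p a
    by (subst A.bracket_antisym; simp)+
  then have "degree (Bracket [:p:] [:q:]) \<le> 0" for p q
    by (rule le)
  then have br: "[:br p q:] = Bracket [:p:] [:q:]" for p q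
    unfolding br_def by (metis coeff_pCons_0 degree_eq_zeroE le_zero_eq)
  \<comment> \<open>Hence \<open>\<mu> p\<close> and \<open>\<beta> p\<close>, the coefficients at 0
    and 1, make up the whole bracket.\<close>
  have "degree (Bracket y2 [:p:]) \<le> 1" for p
    by (rule le) (simp_all add: y2_base y2_y1)
  then have "coeff (Bracket y2 [:p:]) (Suc (Suc n)) = 0" for p n
    by (intro coeff_eq_0 le_less_trans [of "degree (Bracket y2 [:p:])" 1]) simp_all
  then have y2: "Bracket y2 [:p:] = [:\<mu> p, \<beta> p:]" for p
    by (intro poly_eqI) (auto simp: \<mu>_def \<beta>_def coeff_pCons split: nat.split)
  have inner: "poisson_algebra (poly_scale scale) br"
    by (rule poisson_algebra_transfer [where f = "\<lambda>p. [:p:]", OF A.poisson_algebra_axioms])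
      (simp_all add: br inj_def, simp add: poly_scale_def)
  have "poisson_poly_ext (poly_scale scale) br \<beta> \<mu> Bracket"
    using inner A.poisson_algebra_axioms br y2
    by (intro poisson_poly_extI) (simp_all add: y2_def)
  moreover have "poisson_poly_ext scale bracket \<alpha>11 \<nu>1 br"
    using R.poisson_algebra_axioms inner
  proof (rule poisson_poly_extI)
    show "br [:a:] [:b:] = [:bracket a b:]" for a b
      using Bracket_base [of a b] by (simp add: base_def br_def)
    show "br [:0, 1:] [:a:] = [:\<alpha>11 a:] * [:0, 1:] + [:\<nu>1 a:]" for a
      using y1_base [of a] by (simp add: base_def y1_def br_def)
  qed
  ultimately have "presented_y1_y2 scale bracket Bracket \<alpha>11 \<nu>1 \<beta> \<mu>"
    by (auto simp: presented_y1_y2_def iterated_poisson_ext_def)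
  moreover have "\<beta> [:a:] = [:\<alpha>22 a:]" "\<mu> [:a:] = [:\<alpha>21 a:] * [:0, 1:] + [:\<nu>2 a:]" for a
    using y2_base [of a] by (simp_all add: \<beta>_def \<mu>_def base_def)
  moreover have "\<beta> [:0, 1:] = poly_scale scale q12 [:0, 1:] + [:w2:]"
      "\<mu> [:0, 1:] = poly_scale scale q11 ([:0, 1:] ^ 2) + [:w1:] * [:0, 1:] + [:w0:]"
    using y2_y1 by (simp_all add: \<beta>_def \<mu>_def y1_def poly_scale_def power2_eq_square)
  ultimately show ?thesis
    by blast
qed

text \<open>The signs come from \<open>{y1, y2} = - {y2, y1}\<close>. The term
  \<open>q11 * y1^2\<close> would turn into a multiple of \<open>y2^2\<close>, which the shape of a
  double extension does not allow; hence \<open>q11 = 0\<close>.\<close>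

lemma swapped:
  assumes "q11 = 0"
  shows "poisson_double_ext scale bracket 0 (- q12) \<alpha>22 \<alpha>21 \<alpha>12 \<alpha>11 \<nu>2 \<nu>1 (- w2) (- w1) (- w0)
    (\<lambda>p q. swap_vars (Bracket (swap_vars p) (swap_vars q)))"
proof -
  let ?B = "\<lambda>p q. swap_vars (Bracket (swap_vars p) (swap_vars q))"
  let ?s = "poly_scale (poly_scale scale)"
  have "poisson_algebra ?s ?B"
    using A.poisson_algebra_axioms inj_swap_vars swap_vars_add swap_vars_mult swap_vars_poly_scale
    by (rule poisson_algebra_transfer) simp
  moreover have "?B y2 y1 = ?s 0 (y1 ^ 2) + ?s (- q12) (y1 * y2)
      + base (- w2) * y1 + base (- w1) * y2 + base (- w0)"
    using assms A.bracket_antisym [of y1 y2]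
    by (simp add: Bracket_y2_y1 poly_scale_poly_scale swap_vars_add swap_vars_mult
        swap_vars_minus swap_vars_diff base_minus mult.commute)
  ultimately show ?thesis
    using R.poisson_algebra_axioms \<alpha>_linear \<nu>_linear
    by (simp add: poisson_double_ext_def poisson_double_ext_axioms_def Bracket_base
        Bracket_y1_base Bracket_y2_base swap_vars_add swap_vars_mult add.commute)
qed

lemma presentation_y2_y1:
  assumes "\<And>a. \<alpha>21 a = 0" and "q11 = 0"
  shows "\<exists>\<beta> \<mu>. presented_y2_y1 scale bracket Bracket \<alpha>22 \<nu>2 \<beta> \<mu>
          \<and> (\<forall>a. \<beta> [:a:] = [:\<alpha>11 a:])
          \<and> \<beta> [:0, 1:] = - poly_scale scale q12 [:0, 1:] - [:w1:]
          \<and> (\<forall>a. \<mu> [:a:] = [:\<alpha>12 a:] * [:0, 1:] + [:\<nu>1 a:])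
          \<and> \<mu> [:0, 1:] = - ([:w2:] * [:0, 1:]) - [:w0:]"
proof -
  have "presented_y2_y1 scale bracket Bracket \<beta>2 \<delta>2 \<beta>1 \<delta>1"
    if "presented_y1_y2 scale bracket (\<lambda>p q. swap_vars (Bracket (swap_vars p) (swap_vars q)))
      \<beta>2 \<delta>2 \<beta>1 \<delta>1" for \<beta>2 \<delta>2 \<beta>1 \<delta>1
    using that unfolding presented_y1_y2_def presented_y2_y1_def by (intro exI conjI) auto
  \<comment> \<open>For the swapped bracket \<open>\<alpha>21\<close> takes the place of
    \<open>\<alpha>12\<close>, and the inner variable \<open>[:0, 1:]\<close> stands for the
    original \<open>y2\<close>.\<close>
  with poisson_double_ext.presentation_y1_y2 [OF swapped, OF assms(2,1)] show ?thesis
    by (simp add: poly_scale_def) blast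
qed

text \<open>In such a presentation \<open>R[y1]\<close> is closed under the bracket, so
  \<open>{y1, a}\<close> has no \<open>y2\<close> term.\<close>

lemma presented_y1_y2_imp:
  assumes "presented_y1_y2 scale bracket Bracket \<beta>1 \<delta>1 \<beta>2 \<delta>2"
  shows "\<alpha>12 a = 0"
proof -
  obtain br where "poisson_poly_ext (poly_scale scale) br \<beta>2 \<delta>2 Bracket"
    using assms by (auto simp: presented_y1_y2_def iterated_poisson_ext_def)
  then have "Bracket y1 (base a) = [:br [:0, 1:] [:a:]:]"
    by (simp add: poisson_poly_ext.Bracket_const y1_def base_def)
  then have "coeff (coeff (Bracket y1 (base a)) 1) 0 = 0"
    by simp
  then show ?thesis
    by (simp add: Bracket_y1_base) (simp add: base_def y1_def y2_def)
qed

text \<open>Now \<open>R[y2]\<close> is closed, which removes \<open>y1\<close> from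
  \<open>{y2, a}\<close>; and \<open>{y1, y2}\<close> has degree at most one in the outer variable
  \<open>y1\<close>, which excludes \<open>y1^2\<close>.\<close>

lemma presented_y2_y1_imp:
  assumes "presented_y2_y1 scale bracket Bracket \<beta>2 \<delta>2 \<beta>1 \<delta>1"
  shows "\<alpha>21 a = 0" and "q11 = 0"
proof -
  obtain B br where ext: "poisson_poly_ext (poly_scale scale) br \<beta>1 \<delta>1 B"
    and B: "\<And>p q. swap_vars (B p q) = Bracket (swap_vars p) (swap_vars q)"
    using assms by (auto simp: presented_y2_y1_def iterated_poisson_ext_def)
  have "B y1 (base a) = [:br [:0, 1:] [:a:]:]"
    using ext by (simp add: poisson_poly_ext.Bracket_const y1_def base_def)
  \<comment> \<open>After the swap this is the coefficient of \<open>y1\<close> in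
    \<open>{y2, a}\<close>; before it, a coefficient of degree one in the outer variable.\<close>
  then have "coeff (coeff (swap_vars (B y1 (base a))) 0) 1 = 0"
    by (simp add: coeff_swap_vars)
  then show "\<alpha>21 a = 0"
    by (simp add: B Bracket_y2_base) (simp add: base_def y1_def y2_def)
  have "B y2 y1 = [:\<delta>1 [:0, 1:], \<beta>1 [:0, 1:]:]"
    using ext by (simp add: poisson_poly_ext.Bracket_var y1_def y2_def)
  then have "coeff (coeff (swap_vars (B y2 y1)) 0) 2 = 0"
    by (simp add: coeff_swap_vars numeral_2_eq_2)
  then have "coeff (coeff (Bracket y2 y1) 0) 2 = 0"
    by (simp add: B A.bracket_antisym [of y1 y2])
  then have "scale q11 1 = 0"
    by (simp add: Bracket_y2_y1 poly_scale_poly_scale)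
      (simp add: base_def y1_def y2_def power2_eq_square numeral_2_eq_2)
  \<comment> \<open>Scalars form a field and \<open>1\<close> is nonzero in \<open>R\<close>, so the
    scalar itself vanishes.\<close>
  then show "q11 = 0"
    by simp
qed

end

theorem proposition4p1:
  fixes scale :: "'k::field_char_0 \<Rightarrow> 'a::comm_ring_1 \<Rightarrow> 'a"
    and bracket :: "'a \<Rightarrow> 'a \<Rightarrow> 'a"
    and q11 q12 :: 'k
    and \<alpha>11 \<alpha>12 \<alpha>21 \<alpha>22 \<nu>1 \<nu>2 :: "'a \<Rightarrow> 'a"
    and w1 w2 w0 :: 'a
    and Bracket :: "'a poly poly \<Rightarrow> 'a poly poly \<Rightarrow> 'a poly poly"
  assumes "poisson_double_ext scale bracket q11 q12 \<alpha>11 \<alpha>12 \<alpha>21 \<alpha>22 \<nu>1 \<nu>2 w1 w2 w0 Bracket"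
  shows "((\<exists>\<beta>1 \<delta>1 \<beta>2 \<delta>2. presented_y1_y2 scale bracket Bracket \<beta>1 \<delta>1 \<beta>2 \<delta>2) \<or>
          (\<exists>\<beta>2 \<delta>2 \<beta>1 \<delta>1. presented_y2_y1 scale bracket Bracket \<beta>2 \<delta>2 \<beta>1 \<delta>1)
          \<longleftrightarrow> (\<forall>a. \<alpha>12 a = 0) \<or> ((\<forall>a. \<alpha>21 a = 0) \<and> q11 = 0))
    \<and> ((\<forall>a. \<alpha>12 a = 0) \<longrightarrow>
        (\<exists>\<beta> \<mu>. presented_y1_y2 scale bracket Bracket \<alpha>11 \<nu>1 \<beta> \<mu>
          \<and> (\<forall>a. \<beta> [:a:] = [:\<alpha>22 a:])
          \<and> \<beta> [:0, 1:] = poly_scale scale q12 [:0, 1:] + [:w2:]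
          \<and> (\<forall>a. \<mu> [:a:] = [:\<alpha>21 a:] * [:0, 1:] + [:\<nu>2 a:])
          \<and> \<mu> [:0, 1:] = poly_scale scale q11 ([:0, 1:] ^ 2) + [:w1:] * [:0, 1:] + [:w0:]))
    \<and> ((\<forall>a. \<alpha>21 a = 0) \<and> q11 = 0 \<longrightarrow>
        (\<exists>\<beta> \<mu>. presented_y2_y1 scale bracket Bracket \<alpha>22 \<nu>2 \<beta> \<mu>
          \<and> (\<forall>a. \<beta> [:a:] = [:\<alpha>11 a:])
          \<and> \<beta> [:0, 1:] = - poly_scale scale q12 [:0, 1:] - [:w1:]
          \<and> (\<forall>a. \<mu> [:a:] = [:\<alpha>12 a:] * [:0, 1:] + [:\<nu>1 a:])
          \<and> \<mu> [:0, 1:] = - ([:w2:] * [:0, 1:]) - [:w0:]))"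
proof -
  interpret poisson_double_ext scale bracket q11 q12 \<alpha>11 \<alpha>12 \<alpha>21 \<alpha>22 \<nu>1 \<nu>2 w1 w2 w0 Bracket
    by fact
  show ?thesis
    using presentation_y1_y2 presentation_y2_y1 presented_y1_y2_imp presented_y2_y1_imp
    by (intro conjI) (blast | (intro impI; elim conjE; blast))+
qed

end
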